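(* Let $\{\lambda_i\}_{i\ge 1}$ be a sequence of positive integers satisfying $\sum_{i=1}^k\lambda_i \ge \lambda_{k+1}$ for all $k\ge 1$, and let $\{X_i\}_{i\ge 1}$ be independent random variables such that, for each $i\ge 1$, $X_i$ is a Poisson random variable of mean $\lambda_i$. Then, for every $k\ge 1$, $$\mathbb{P}\left( \sum_{i=1}^kX_i\ge \sum_{i=1}^{k} \lambda_i \right) \ \ge\ \mathbb{P}\left( \sum_{i=1}^{k+1}X_i\ge\sum_{i=1}^{k+1} \lambda_i \right).$$ *)

theory Defs
  imports "HOL-Probability.Probability"
begin

end

theory Submission
  imports Defs
begin

text \<open>
  A sum of independent Poisson variables is Poisson, so with \<open>n = \<lambda>\<^sub>1 + \<dots> + \<lambda>\<^sub>k\<close> and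
  \<open>m = \<lambda>\<^sub>1 + \<dots> + \<lambda>\<^sub>k\<^sub>+\<^sub>1\<close> the claim compares \<open>P(Poi(n) \<ge> n)\<close> with \<open>P(Poi(m) \<ge> m)\<close> for
  positive integers \<open>n \<le> m\<close>. It therefore follows once \<open>F n = P(Poi(n) < n)\<close> is known to
  be nondecreasing in \<open>n\<close> (\<open>poisson_less_mean_mono\<close>), and for this one step suffices.

  Passing from \<open>n\<close> to \<open>n + 1\<close> changes both the threshold and the mean. Raising the
  threshold adds the single mass \<open>g n\<close>, where \<open>g t = t\<^sup>n / n! \<cdot> exp (-t)\<close>. Raising the mean
  removes \<open>\<integral> g\<close> over \<open>[n, n + 1]\<close>, because \<open>-g\<close> is the derivative of
  \<open>t \<mapsto> P(Poi(t) \<le> n)\<close>: the derivative of the Poisson distribution function telescopes.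
  Since \<open>g\<close> attains its maximum at \<open>t = n\<close>, the loss is at most the gain.
\<close>

section \<open>Sums of independent Poisson variables\<close>

text \<open>The factors \<open>exp (-a)\<close> and \<open>exp (-b)\<close> multiply to \<open>exp (-(a + b))\<close>; what is left is
  the binomial theorem for \<open>(a + b)\<^sup>n\<close>, divided by \<open>n!\<close>.\<close>

lemma poisson_pmf_convolution:
  fixes a b :: real
  assumes "a > 0" "b > 0"
  shows "(\<Sum>i\<le>n. pmf (poisson_pmf a) i * pmf (poisson_pmf b) (n - i)) = pmf (poisson_pmf (a + b)) n"
proof -
  have "(\<Sum>i\<le>n. pmf (poisson_pmf a) i * pmf (poisson_pmf b) (n - i))
      = (\<Sum>i\<le>n. of_nat (n choose i) * a ^ i * b ^ (n - i) * (exp (- (a + b)) / fact n))"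
  proof (rule sum.cong)
    fix i assume "i \<in> {..n}"
    then have "real (n choose i) = fact n / (fact i * fact (n - i))"
      by (simp add: binomial_fact)
    then show "pmf (poisson_pmf a) i * pmf (poisson_pmf b) (n - i)
        = of_nat (n choose i) * a ^ i * b ^ (n - i) * (exp (- (a + b)) / fact n)"
      using assms by (simp add: exp_diff exp_minus field_simps)
  qed simp
  also have "\<dots> = (a + b) ^ n * (exp (- (a + b)) / fact n)"
    by (simp only: binomial_ring sum_distrib_right)
  finally show ?thesis
    using assms by simp
qed

context prob_space
begin

lemma distr_sum_indep_poisson:
  fixes X Y :: "'a \<Rightarrow> nat"
  assumes indep: "indep_var (count_space UNIV) X (count_space UNIV) Y"
    and pos: "a > 0" "b > 0"
    and X: "distr M (count_space UNIV) X = measure_pmf (poisson_pmf a)"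
    and Y: "distr M (count_space UNIV) Y = measure_pmf (poisson_pmf b)"
  shows "distr M (count_space UNIV) (\<lambda>\<omega>. X \<omega> + Y \<omega>) = measure_pmf (poisson_pmf (a + b))"
proof -
  have rv [measurable]: "X \<in> M \<rightarrow>\<^sub>M count_space UNIV" "Y \<in> M \<rightarrow>\<^sub>M count_space UNIV"
    using indep_var_rv1[OF indep] indep_var_rv2[OF indep] by simp_all
  have pX: "prob (X -` {i} \<inter> space M) = pmf (poisson_pmf a) i" for i
    using measure_distr[OF rv(1), of "{i}"] by (simp add: X measure_pmf_single)
  have pY: "prob (Y -` {i} \<inter> space M) = pmf (poisson_pmf b) i" for i
    using measure_distr[OF rv(2), of "{i}"] by (simp add: Y measure_pmf_single)
  let ?E = "\<lambda>n i. (\<lambda>\<omega>. (X \<omega>, Y \<omega>)) -` ({i} \<times> {n - i}) \<inter> space M"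
  have sets: "?E n i \<in> events" for n i
  proof -
    have "?E n i = {\<omega> \<in> space M. X \<omega> = i \<and> Y \<omega> = n - i}"
      by auto
    then show ?thesis
      by simp
  qed
  have p: "prob ((\<lambda>\<omega>. X \<omega> + Y \<omega>) -` {n} \<inter> space M) = pmf (poisson_pmf (a + b)) n" for n
  proof -
    have "(\<lambda>\<omega>. X \<omega> + Y \<omega>) -` {n} \<inter> space M = (\<Union>i\<in>{..n}. ?E n i)"
      by auto
    also have "prob \<dots> = (\<Sum>i\<le>n. prob (?E n i))"
      using sets by (intro finite_measure_finite_Union) (auto simp: disjoint_family_on_def)
    also have "\<dots> = (\<Sum>i\<le>n. pmf (poisson_pmf a) i * pmf (poisson_pmf b) (n - i))"
      using indep_varD[OF indep, of "{_}" "{_}"] by (intro sum.cong) (simp_all add: pX pY)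
    finally show ?thesis
      by (simp add: poisson_pmf_convolution[OF pos])
  qed
  show ?thesis
  proof (rule measure_eqI_countable[where A = UNIV])
    fix n :: nat
    show "emeasure (distr M (count_space UNIV) (\<lambda>\<omega>. X \<omega> + Y \<omega>)) {n}
        = emeasure (measure_pmf (poisson_pmf (a + b))) {n}"
      using p[of n] by (simp add: emeasure_distr emeasure_eq_measure emeasure_pmf_single)
  qed simp_all
qed

lemma indep_var_sum_nat:
  fixes X :: "'i \<Rightarrow> 'a \<Rightarrow> nat"
  assumes I: "finite I" "i \<notin> I"
    and indep: "indep_vars (\<lambda>_. count_space UNIV) X (insert i I)"
  shows "indep_var (count_space UNIV) (\<lambda>\<omega>. \<Sum>j\<in>I. X j \<omega>) (count_space UNIV) (X i)"
proof -
  \<comment> \<open>On \<open>nat\<close> the discrete and the Borel structure agree, which makes finite sums measurable.\<close>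
  have "(\<lambda>f. \<Sum>j\<in>I. f j) \<in> PiM I (\<lambda>_. borel) \<rightarrow>\<^sub>M (borel :: nat measure)"
    by measurable
  moreover have "sets (PiM I (\<lambda>_. borel :: nat measure)) = sets (PiM I (\<lambda>_. count_space UNIV))"
    by (intro sets_PiM_cong) (simp_all add: sets_borel_eq_count_space)
  ultimately have "(\<lambda>f. \<Sum>j\<in>I. f j) \<in> PiM I (\<lambda>_. count_space UNIV) \<rightarrow>\<^sub>M (count_space UNIV :: nat measure)"
    by (simp cong: measurable_cong_sets add: measurable_cong_sets[OF _ sets_borel_eq_count_space])
  then have "indep_var
      (count_space UNIV) ((\<lambda>f. \<Sum>j\<in>I. f j) \<circ> (\<lambda>\<omega>. restrict (\<lambda>j. X j \<omega>) I))
      (count_space UNIV) ((\<lambda>f. f i) \<circ> (\<lambda>\<omega>. restrict (\<lambda>j. X j \<omega>) {i}))"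
    using I by (intro indep_var_compose[OF indep_var_restrict[OF indep]]) auto
  then show ?thesis
    by (simp add: comp_def cong: sum.cong)
qed

lemma distr_sum_indep_poissons:
  fixes X :: "'i \<Rightarrow> 'a \<Rightarrow> nat" and r :: "'i \<Rightarrow> real"
  assumes "finite I" "I \<noteq> {}"
    and "indep_vars (\<lambda>_. count_space UNIV) X I"
    and "\<And>i. i \<in> I \<Longrightarrow> r i > 0"
    and "\<And>i. i \<in> I \<Longrightarrow> distr M (count_space UNIV) (X i) = measure_pmf (poisson_pmf (r i))"
  shows "distr M (count_space UNIV) (\<lambda>\<omega>. \<Sum>i\<in>I. X i \<omega>) = measure_pmf (poisson_pmf (\<Sum>i\<in>I. r i))"
  using assms
proof (induction I rule: finite_ne_induct)
  case (singleton i)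
  then show ?case by simp
next
  case (insert i I)
  have "distr M (count_space UNIV) (\<lambda>\<omega>. \<Sum>j\<in>I. X j \<omega>) = measure_pmf (poisson_pmf (\<Sum>j\<in>I. r j))"
    using insert.prems by (intro insert.IH) (auto intro: indep_vars_subset)
  moreover have "(\<Sum>j\<in>I. r j) > 0"
    using insert by (intro sum_pos) auto
  ultimately have "distr M (count_space UNIV) (\<lambda>\<omega>. (\<Sum>j\<in>I. X j \<omega>) + X i \<omega>)
      = measure_pmf (poisson_pmf ((\<Sum>j\<in>I. r j) + r i))"
    using insert by (intro distr_sum_indep_poisson indep_var_sum_nat) auto
  then show ?case
    using insert.hyps by (simp add: add.commute)
qed

end

section \<open>A Poisson variable falling below its integer mean\<close>

lemma prob_poisson_lessThan:
  assumes "t > 0"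
  shows "measure_pmf.prob (poisson_pmf t) {..<n} = (\<Sum>j<n. t ^ j / fact j * exp (- t))"
  using assms by (simp add: measure_measure_pmf_finite)

text \<open>The term \<open>t\<^sup>j / j! \<cdot> exp (-t)\<close> has as derivative the term of index \<open>j - 1\<close> minus the
  term of index \<open>j\<close>, so the sum telescopes and only its last term is left.\<close>

lemma poisson_cdf_deriv:
  fixes t :: real
  shows "((\<lambda>t. \<Sum>j<Suc n. t ^ j / fact j * exp (- t)) has_real_derivative
           - (t ^ n / fact n * exp (- t))) (at t)"
proof (induction n)
  case 0
  show ?case
    by (auto intro!: derivative_eq_intros)
next
  case (Suc n)
  have "((\<lambda>t. t ^ Suc n / fact (Suc n) * exp (- t)) has_real_derivative
          t ^ n / fact n * exp (- t) - t ^ Suc n / fact (Suc n) * exp (- t)) (at t)"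
    by (rule derivative_eq_intros refl | simp)+
  from DERIV_add[OF Suc this] show ?case
    by simp
qed

text \<open>Dividing by \<open>n\<^sup>n exp (-n)\<close> turns this into \<open>(1 + x / n)\<^sup>n \<le> exp x\<close> for \<open>x = t - n\<close>.\<close>

lemma power_exp_le_at_exponent:
  fixes t :: real
  assumes "n > 0" "t \<ge> 0"
  shows "t ^ n * exp (- t) \<le> real n ^ n * exp (- real n)"
proof -
  have "(1 + (t - real n) / real n) ^ n \<le> exp (t - real n)"
    using assms by (intro exp_ge_one_plus_x_over_n_power_n) auto
  then have "(t / real n) ^ n \<le> exp (t - real n)"
    using assms by (simp add: field_simps)
  then show ?thesis
    using assms by (simp add: power_divide exp_diff exp_minus field_simps)
qed

lemma poisson_less_mean_step:
  assumes "n > 0"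
  shows "measure_pmf.prob (poisson_pmf (real n)) {..<n}
       \<le> measure_pmf.prob (poisson_pmf (real (Suc n))) {..<Suc n}"
proof -
  define S where "S t = (\<Sum>j<Suc n. t ^ j / fact j * exp (- t))" for t :: real
  obtain t where t: "real n < t" "t < real (Suc n)"
    and "S (real (Suc n)) - S (real n) = (real (Suc n) - real n) * - (t ^ n / fact n * exp (- t))"
    using MVT2[of "real n" "real (Suc n)" S "\<lambda>t. - (t ^ n / fact n * exp (- t))"]
      poisson_cdf_deriv[of n] unfolding S_def by auto
  then have "S (real (Suc n)) = S (real n) - t ^ n * exp (- t) / fact n"
    by simp
  also have "\<dots> \<ge> S (real n) - real n ^ n * exp (- real n) / fact n"
    using power_exp_le_at_exponent[OF assms, of t] t by (simp add: divide_right_mono)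
  also have "S (real n) - real n ^ n * exp (- real n) / fact n
      = (\<Sum>j<n. real n ^ j / fact j * exp (- real n))"
    by (simp add: S_def)
  finally show ?thesis
    using assms by (simp add: prob_poisson_lessThan S_def del: of_nat_Suc sum.lessThan_Suc)
qed

lemma poisson_less_mean_mono:
  assumes "0 < n" "n \<le> m"
  shows "measure_pmf.prob (poisson_pmf (real n)) {..<n}
       \<le> measure_pmf.prob (poisson_pmf (real m)) {..<m}"
  using assms(2)
proof (induction rule: dec_induct)
  case (step m)
  then show ?case
    using poisson_less_mean_step[of m] assms(1) by linarith
qed simp

lemma poisson_at_least_mean_antimono:
  assumes "0 < n" "n \<le> m"
  shows "measure_pmf.prob (poisson_pmf (real m)) {m..}
       \<le> measure_pmf.prob (poisson_pmf (real n)) {n..}"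
proof -
  have "measure_pmf.prob p {j..} = 1 - measure_pmf.prob p {..<j}" for p and j :: nat
    using measure_pmf.prob_compl[of "{..<j}" p] by (simp add: Compl_eq_Diff_UNIV[symmetric])
  then show ?thesis
    using poisson_less_mean_mono[OF assms] by simp
qed

section \<open>Comparison of consecutive partial sums\<close>

theorem theorem3p1:
  fixes M :: "'a measure"
    and X :: "nat \<Rightarrow> 'a \<Rightarrow> nat"
    and lam :: "nat \<Rightarrow> nat"
    and k :: nat
  assumes "prob_space M"
    and "\<And>i. i \<ge> 1 \<Longrightarrow> lam i > 0"
    and "\<And>j. j \<ge> 1 \<Longrightarrow> (\<Sum>i=1..j. lam i) \<ge> lam (j + 1)"
    and "prob_space.indep_vars M (\<lambda>_. count_space UNIV) X {1..}"
    and "\<And>i. i \<ge> 1 \<Longrightarrow>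
           distr M (count_space UNIV) (X i) = measure_pmf (poisson_pmf (real (lam i)))"
    and "k \<ge> 1"
  shows "measure M {\<omega> \<in> space M. (\<Sum>i=1..k. X i \<omega>) \<ge> (\<Sum>i=1..k. lam i)}
       \<ge> measure M {\<omega> \<in> space M. (\<Sum>i=1..k+1. X i \<omega>) \<ge> (\<Sum>i=1..k+1. lam i)}"
proof -
  interpret prob_space M by fact
  have tail: "measure M {\<omega> \<in> space M. (\<Sum>i=1..j. X i \<omega>) \<ge> (\<Sum>i=1..j. lam i)}
      = measure_pmf.prob (poisson_pmf (real (\<Sum>i=1..j. lam i))) {(\<Sum>i=1..j. lam i)..}"
    if "j \<ge> 1" for j
  proof -
    have "distr M (count_space UNIV) (\<lambda>\<omega>. \<Sum>i=1..j. X i \<omega>)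
        = measure_pmf (poisson_pmf (\<Sum>i=1..j. real (lam i)))"
      using that assms by (intro distr_sum_indep_poissons) (auto intro: indep_vars_subset)
    moreover have "(\<lambda>\<omega>. \<Sum>i=1..j. X i \<omega>) \<in> M \<rightarrow>\<^sub>M count_space UNIV"
      \<comment> \<open>The sum is one component of an independent pair whose other component is the next term.\<close>
      using assms(4) by (intro indep_var_rv1[OF indep_var_sum_nat[of "{1..j}" "Suc j" X]])
        (auto intro: indep_vars_subset)
    ultimately show ?thesis
      using measure_distr[of "\<lambda>\<omega>. \<Sum>i=1..j. X i \<omega>" M "count_space UNIV" "{(\<Sum>i=1..j. lam i)..}"]
      by (simp add: vimage_def Int_def conj_commute)
  qed
  have "0 < (\<Sum>i=1..k. lam i)"
    using assms(2) \<open>k \<ge> 1\<close> by (intro sum_pos) auto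
  then have "measure_pmf.prob (poisson_pmf (real (\<Sum>i=1..k+1. lam i))) {(\<Sum>i=1..k+1. lam i)..}
      \<le> measure_pmf.prob (poisson_pmf (real (\<Sum>i=1..k. lam i))) {(\<Sum>i=1..k. lam i)..}"
    by (intro poisson_at_least_mean_antimono) auto
  then show ?thesis
    using tail[of k] tail[of "k + 1"] \<open>k \<ge> 1\<close> by simp
qed

end
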